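(* Let $r\ge1$ and let $a_1,\dots,a_r$ be nonzero complex numbers, let $s$ be a nonnegative integer and $\lambda\in\mathbb C$ with $\lambda\ne1$. For every integer $n\ge0$, $$D_n(x|a_1,\dots,a_r)=\sum_{m=0}^n\left(\sum_{j=0}^{n-m}\sum_{l=0}^{n-m-j}\binom{s}{j}\binom{n-j}{l}(n)_j(1-\lambda)^{-j}S_1(n-j-l,m)D_l(a_1,\dots,a_r)\right)H_m^{(s)}(x|\lambda),$$ $$\widehat D_n(x|a_1,\dots,a_r)=\sum_{m=0}^n\left(\sum_{j=0}^{n-m}\sum_{l=0}^{n-m-j}\binom{s}{j}\binom{n-j}{l}(n)_j(1-\lambda)^{-j}S_1(n-j-l,m)\widehat D_l(a_1,\dots,a_r)\right)H_m^{(s)}(x|\lambda).$$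
   Context: For nonzero complex $a_1,\dots,a_r$, the Barnes-type Daehee polynomials of the first and second kind are defined by the formal power series identities $\prod_{j=1}^r\frac{\ln(1+t)}{(1+t)^{a_j}-1}(1+t)^x=\sum_{n\ge0}D_n(x|a_1,\dots,a_r)\frac{t^n}{n!}$ and $\prod_{j=1}^r\frac{(1+t)^{a_j}\ln(1+t)}{(1+t)^{a_j}-1}(1+t)^x=\sum_{n\ge0}\widehat D_n(x|a_1,\dots,a_r)\frac{t^n}{n!}$; the numbers are $D_n(a_1,\dots,a_r)=D_n(0|a_1,\dots,a_r)$, $\widehat D_n(a_1,\dots,a_r)=\widehat D_n(0|a_1,\dots,a_r)$. The Frobenius–Euler polynomials of order $s$ are defined by $\left(\frac{1-\lambda}{e^t-\lambda}\right)^se^{xt}=\sum_{n\ge0}H_n^{(s)}(x|\lambda)\frac{t^n}{n!}$. $(n)_j=n(n-1)\cdots(n-j+1)$, $(n)_0=1$, and $S_1(n,m)$ are the signed Stirling numbers of the first kind: $(x)_n=\sum_{m=0}^nS_1(n,m)x^m$. *)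

theory Defs
  imports
    "HOL-Computational_Algebra.Polynomial"
    "HOL-Computational_Algebra.Formal_Power_Series"
begin

definition ffact :: "'a::comm_ring_1 \<Rightarrow> nat \<Rightarrow> 'a" where
  "ffact x n = (\<Prod>i<n. x - of_nat i)"

text \<open>Signed Stirling numbers of the first kind. The library's \<open>stirling\<close> is the unsigned
  version, so they are defined here as the coefficients of the falling factorial polynomial.\<close>

definition S1 :: "nat \<Rightarrow> nat \<Rightarrow> int" where
  "S1 n m = poly.coeff (ffact [:0, 1:] n) m"

text \<open>In the following, \<open>fps_ln 1\<close> is the series of \<open>ln (1 + t)\<close> and \<open>fps_binomial c\<close> that of
  \<open>(1 + t)\<^sup>c\<close>. For \<open>a j \<noteq> 0\<close> numerator and denominator of each factor both
  vanish to order exactly one at \<open>t = 0\<close>, so the truncating division of formal power series is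
  the exact quotient (see \<open>fps_ln_quotient\<close> below).\<close>

definition daehee_gf :: "nat \<Rightarrow> (nat \<Rightarrow> complex) \<Rightarrow> complex \<Rightarrow> complex fps" where
  "daehee_gf r a x =
     (\<Prod>j=1..r. fps_ln 1 / (fps_binomial (a j) - 1)) * fps_binomial x"

definition daehee2_gf :: "nat \<Rightarrow> (nat \<Rightarrow> complex) \<Rightarrow> complex \<Rightarrow> complex fps" where
  "daehee2_gf r a x =
     (\<Prod>j=1..r. (fps_binomial (a j) * fps_ln 1) / (fps_binomial (a j) - 1)) * fps_binomial x"

definition frobenius_euler_gf :: "nat \<Rightarrow> complex \<Rightarrow> complex \<Rightarrow> complex fps" where
  "frobenius_euler_gf s l x =
     (fps_const (1 - l) / (fps_exp 1 - fps_const l)) ^ s * fps_exp x"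

definition daehee_poly :: "nat \<Rightarrow> (nat \<Rightarrow> complex) \<Rightarrow> nat \<Rightarrow> complex \<Rightarrow> complex" where
  "daehee_poly r a n x = fact n * fps_nth (daehee_gf r a x) n"

definition daehee2_poly :: "nat \<Rightarrow> (nat \<Rightarrow> complex) \<Rightarrow> nat \<Rightarrow> complex \<Rightarrow> complex" where
  "daehee2_poly r a n x = fact n * fps_nth (daehee2_gf r a x) n"

definition frobenius_euler_poly :: "nat \<Rightarrow> complex \<Rightarrow> nat \<Rightarrow> complex \<Rightarrow> complex" where
  "frobenius_euler_poly s l n x = fact n * fps_nth (frobenius_euler_gf s l x) n"

abbreviation daehee_number :: "nat \<Rightarrow> (nat \<Rightarrow> complex) \<Rightarrow> nat \<Rightarrow> complex" where
  "daehee_number r a n \<equiv> daehee_poly r a n 0"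

abbreviation daehee2_number :: "nat \<Rightarrow> (nat \<Rightarrow> complex) \<Rightarrow> nat \<Rightarrow> complex" where
  "daehee2_number r a n \<equiv> daehee2_poly r a n 0"

lemma daehee_gf_eq: "daehee_gf r a x = Abs_fps (\<lambda>n. daehee_poly r a n x / fact n)"
  by (simp add: fps_eq_iff daehee_poly_def)

lemma daehee2_gf_eq: "daehee2_gf r a x = Abs_fps (\<lambda>n. daehee2_poly r a n x / fact n)"
  by (simp add: fps_eq_iff daehee2_poly_def)

lemma frobenius_euler_gf_eq:
  "frobenius_euler_gf s l x = Abs_fps (\<lambda>n. frobenius_euler_poly s l n x / fact n)"
  by (simp add: fps_eq_iff frobenius_euler_poly_def)

lemma fps_ln_quotient:
  fixes c :: complex
  assumes "c \<noteq> 0"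
  shows "fps_ln 1 / (fps_binomial c - 1) * (fps_binomial c - 1) = fps_ln 1"
    and "(fps_binomial c * fps_ln 1) / (fps_binomial c - 1) * (fps_binomial c - 1)
           = fps_binomial c * fps_ln 1"
proof -
  have nz: "fps_nth (fps_binomial c - 1) 1 \<noteq> 0" using assms by simp
  then have nz': "fps_binomial c - 1 \<noteq> 0" by (metis fps_zero_nth)
  have sd: "subdegree (fps_binomial c - 1) = 1"
    using nz by (intro subdegreeI) auto
  have ln: "fps_X dvd (fps_ln 1 :: complex fps)" by (rule fps_X_dvd_fps_ln)
  have "fps_binomial c - 1 dvd (fps_X :: complex fps)"
    using nz' sd by (subst fps_dvd_iff) auto
  then have "fps_binomial c - 1 dvd (fps_ln 1 :: complex fps)" using ln dvd_trans by blast
  then show "fps_ln 1 / (fps_binomial c - 1) * (fps_binomial c - 1) = fps_ln 1"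
    and "(fps_binomial c * fps_ln 1) / (fps_binomial c - 1) * (fps_binomial c - 1)
           = fps_binomial c * fps_ln 1"
    by simp_all
qed

lemma degree_ffact: "degree (ffact [:0, 1:] n :: int poly) \<le> n"
proof (induction n)
  case (Suc n)
  have "degree ([:0, 1:] - of_nat n :: int poly) \<le> 1"
    by (rule degree_diff_le) simp_all
  with Suc show ?case
    unfolding ffact_def prod.lessThan_Suc
    by (intro order.trans[OF degree_mult_le]) simp
qed (simp add: ffact_def)

lemma ffact_eq_sum_S1:
  fixes x :: int
  shows "ffact x n = (\<Sum>m=0..n. S1 n m * x ^ m)"
proof -
  have "ffact x n = poly (ffact [:0, 1:] n) x"
    by (simp add: ffact_def poly_prod)
  also have "\<dots> = (\<Sum>m\<le>n. S1 n m * x ^ m)"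
    unfolding S1_def poly_altdef
    by (rule sum.mono_neutral_left) (use degree_ffact[of n] in \<open>auto intro: coeff_eq_0\<close>)
  finally show ?thesis by (simp add: atMost_atLeast0)
qed

end

theory Submission
  imports Defs
begin

text \<open>Substituting \<open>ln (1 + t)\<close> for \<open>t\<close> in the Frobenius-Euler generating function and clearing
  its denominator gives
  \<open>(1 + t)\<^sup>x = (1 + t / (1 - \<lambda>))\<^sup>s * (\<Sum>m. H\<^sub>m * ln (1 + t)^m / m!)\<close>.
  Since \<open>ln (1 + t)^m / m!\<close> is the exponential generating function of \<open>S\<^sub>1(n, m)\<close>, multiplying by
  the generating function of the Daehee numbers and comparing coefficients yields both identities.\<close>

lemma ffact_Suc: "ffact x (Suc n) = ffact x n * (x - of_nat n)"
  by (simp add: ffact_def)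

lemma S1_0_left: "S1 0 m = (if m = 0 then 1 else 0)"
  by (simp add: S1_def ffact_def)

text \<open>Compares coefficients in \<open>(x)_(n+1) = (x)_n * (x - n)\<close>; multiplication by
  \<open>x\<close> shifts them by one, with nothing shifted into position 0.\<close>

lemma S1_Suc_left: "S1 (Suc n) m = (if m = 0 then 0 else S1 n (m - 1)) - int n * S1 n m"
proof -
  have "ffact [:0, 1:] (Suc n) = pCons 0 (ffact [:0, 1:] n) - smult (int n) (ffact [:0, 1:] n)"
    by (simp add: ffact_Suc of_nat_poly algebra_simps)
  then show ?thesis
    by (cases m) (simp_all add: S1_def)
qed

lemma fps_ln_1_deriv: "(1 + fps_X) * fps_deriv (fps_ln 1) = (1 :: 'a::field_char_0 fps)"
  by (simp add: fps_ln_deriv inverse_mult_eq_1')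

text \<open>Both sides solve \<open>(1 + t) F' = c F\<close> with constant term 1, and this solution
  is unique.\<close>

lemma fps_exp_compose_ln: "fps_exp c oo fps_ln 1 = fps_binomial (c :: 'a::field_char_0)"
proof (subst fps_binomial_ODE_unique'[symmetric], intro conjI)
  show "fps_deriv (fps_exp c oo fps_ln 1) = fps_const c * (fps_exp c oo fps_ln 1) / (1 + fps_X)"
    by (simp add: fps_compose_deriv fps_ln_deriv fps_divide_unit fps_const_mult_apply_left)
qed simp

text \<open>With \<open>L = ln (1 + t)\<close>, the equation
  \<open>(1 + t) (L^(k+1))' = (k+1) L^k\<close> turns into the recurrence of \<open>S1\<close> on
  coefficients. It involves both exponents \<open>k\<close> and \<open>k+1\<close>, so the induction
  on \<open>n\<close> keeps \<open>m\<close> arbitrary.\<close>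

lemma fps_ln_power_nth:
  "fact n * fps_nth (fps_ln 1 ^ m) n = (fact m * of_int (S1 n m) :: 'a::field_char_0)"
proof (induction n arbitrary: m)
  case 0
  show ?case by (cases m) (simp_all add: S1_0_left)
next
  case (Suc n)
  show ?case
  proof (cases m)
    case 0
    \<comment> \<open>The recurrence leaves \<open>- n * S1 n 0\<close>: the factor vanishes for
      \<open>n = 0\<close>, and otherwise the induction hypothesis gives
      \<open>S1 n 0 = 0\<close>.\<close>
    with Suc[of 0] show ?thesis by (cases n) (simp_all add: S1_Suc_left)
  next
    case (Suc k)
    let ?L = "fps_ln 1 :: 'a fps"
    have "(1 + fps_X) * fps_deriv (?L ^ Suc k)
        = of_nat (Suc k) * ?L ^ k * ((1 + fps_X) * fps_deriv ?L)"
      unfolding fps_deriv_power' by (simp only: diff_Suc_1 mult_ac)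
    then have "fps_nth ((1 + fps_X) * fps_deriv (?L ^ Suc k)) n
        = fps_nth (of_nat (Suc k) * ?L ^ k) n"
      by (simp add: fps_ln_1_deriv)
    moreover have "fps_nth (fps_X * fps_deriv F) n = of_nat n * fps_nth F n" for F :: "'a fps"
      by (cases n) simp_all
    ultimately have recurrence: "of_nat (Suc n) * fps_nth (?L ^ Suc k) (Suc n)
        = of_nat (Suc k) * fps_nth (?L ^ k) n - of_nat n * fps_nth (?L ^ Suc k) n"
      by (simp add: distrib_right eq_diff_eq del: power_Suc of_nat_Suc)
    have "fact (Suc n) * fps_nth (?L ^ Suc k) (Suc n)
        = fact n * (of_nat (Suc n) * fps_nth (?L ^ Suc k) (Suc n))"
      by (simp only: fact_Suc of_nat_mult of_nat_fact mult_ac)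
    also have "\<dots> = of_nat (Suc k) * (fact n * fps_nth (?L ^ k) n)
          - of_nat n * (fact n * fps_nth (?L ^ Suc k) n)"
      unfolding recurrence by (simp only: right_diff_distrib mult_ac)
    also have "\<dots> = fact (Suc k) * of_int (S1 (Suc n) (Suc k))"
      unfolding Suc.IH by (simp add: S1_Suc_left algebra_simps)
    finally show ?thesis using Suc by simp
  qed
qed

lemma frobenius_euler_gf_compose_ln:
  assumes "l \<noteq> 1"
  shows "fps_binomial x
    = (1 + fps_const (inverse (1 - l)) * fps_X) ^ s * (frobenius_euler_gf s l x oo fps_ln 1)"
proof -
  let ?L = "fps_ln 1 :: complex fps"
  let ?E = "fps_exp 1 - fps_const l" and ?c = "fps_const (1 - l)"
  have E: "fps_nth ?E 0 \<noteq> 0" using assms by simp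
  have "?E ^ s * frobenius_euler_gf s l x = (?c / ?E * ?E) ^ s * fps_exp x"
    by (simp add: frobenius_euler_gf_def power_mult_distrib mult_ac)
  also have "?c / ?E * ?E = ?c"
    using E by (simp add: fps_divide_unit mult.assoc inverse_mult_eq_1)
  \<comment> \<open>Composition with \<open>?L\<close> respects products and powers because
    \<open>?L\<close> has constant term 0.\<close>
  finally have "(?E oo ?L) ^ s * (frobenius_euler_gf s l x oo ?L)
      = (?c oo ?L) ^ s * (fps_exp x oo ?L)"
    by (metis fps_compose_mult_distrib fps_compose_power fps_ln_0)
  \<comment> \<open>The denominator becomes \<open>1 + t - l\<close>, from which the constant
    \<open>1 - l\<close> is split off so that it cancels against the numerator.\<close>
  moreover have "?E oo ?L = ?c * (1 + fps_const (inverse (1 - l)) * fps_X)"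
  proof -
    have "?c * (1 + fps_const (inverse (1 - l)) * fps_X) = ?c + (?c * fps_const (inverse (1 - l))) * fps_X"
      by (simp only: distrib_left mult.assoc mult_1_right)
    also have "?c * fps_const (inverse (1 - l)) = 1"
      using assms by simp
    finally show ?thesis
      by (simp add: fps_compose_sub_distrib fps_exp_compose_ln fps_binomial_1 flip: fps_const_sub)
  qed
  ultimately have "?c ^ s * ((1 + fps_const (inverse (1 - l)) * fps_X) ^ s
      * (frobenius_euler_gf s l x oo ?L)) = ?c ^ s * fps_binomial x"
    by (simp add: fps_exp_compose_ln power_mult_distrib mult.assoc del: fps_const_sub)
  moreover have "?c ^ s \<noteq> 0" using assms by simp
  ultimately show ?thesis by (metis mult_left_cancel)
qed

text \<open>The \<open>m!\<close> from the coefficients of \<open>ln (1 + t)^m\<close> cancels the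
  \<open>m!\<close> dividing the Frobenius-Euler polynomial; powers with \<open>m > n\<close> do not
  reach degree \<open>n\<close>.\<close>

lemma frobenius_euler_gf_compose_ln_nth:
  "fact n * fps_nth (frobenius_euler_gf s l x oo fps_ln 1) n
    = (\<Sum>m=0..n. of_int (S1 n m) * frobenius_euler_poly s l m x)"
  unfolding fps_compose_nth sum_distrib_left
  by (intro sum.cong refl)
    (simp add: frobenius_euler_poly_def fps_ln_power_nth mult.left_commute mult.commute)

text \<open>The substitution of \<open>c t\<close> for \<open>t\<close> in \<open>(1 + t)^s\<close>
  scales the coefficient at \<open>j\<close> by \<open>c^j\<close>.\<close>

lemma one_plus_const_X_power_nth:
  "fps_nth ((1 + fps_const c * fps_X) ^ s) j = of_nat (s choose j) * (c :: 'a::field_char_0) ^ j"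
proof -
  have "(1 + fps_const c * fps_X) ^ s = (1 + fps_X) ^ s oo (fps_const c * fps_X)"
    by (simp add: fps_compose_add_distrib flip: fps_compose_power)
  then have "fps_nth ((1 + fps_const c * fps_X) ^ s) j = c ^ j * fps_nth ((1 + fps_X) ^ s) j"
    by (simp only: fps_nth_compose_linear)
  then show ?thesis
    by (simp add: binomial_gbinomial flip: fps_binomial_of_nat)
qed

text \<open>Distributes \<open>n!\<close> over the three factors of a Cauchy product: the first gets
  the falling factorial \<open>n! / (n - j)!\<close>, while a binomial coefficient splits
  \<open>(n - j)!\<close> between the other two.\<close>

lemma fact_eq_binomial_ffact:
  assumes "j + k \<le> n"
  shows "(fact n :: 'a::field_char_0)
    = of_nat ((n - j) choose k) * ffact (of_nat n) j * (fact k * fact (n - j - k))"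
proof -
  have "fact n = fact (n - j) * (ffact (of_nat n) j :: 'a)"
    using assms
    by (simp add: ffact_def lessThan_atLeast0 binomial_fact
        flip: gbinomial_mult_fact binomial_gbinomial)
  moreover have "(fact (n - j) :: 'a) = of_nat ((n - j) choose k) * (fact k * fact (n - j - k))"
    using assms by (simp add: binomial_fact)
  ultimately show ?thesis by (simp add: mult_ac)
qed

text \<open>Both sides run over all triples with \<open>j + k + m \<le> n\<close>.\<close>

lemma sum_simplex_swap:
  fixes f :: "nat \<Rightarrow> nat \<Rightarrow> nat \<Rightarrow> 'a::comm_monoid_add"
  shows "(\<Sum>j=0..n. \<Sum>k=0..n - j. \<Sum>m=0..n - j - k. f j k m)
    = (\<Sum>m=0..n. \<Sum>j=0..n - m. \<Sum>k=0..n - m - j. f j k m)"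
  by (simp add: sum.Sigma split_def,
      rule sum.reindex_bij_witness[where i = "\<lambda>(m, j, k). (j, k, m)"
        and j = "\<lambda>(j, k, m). (m, j, k)"]) auto

text \<open>The series \<open>G\<close> is arbitrary so that one computation serves both kinds of
  Daehee polynomials; \<open>fact k * fps_nth G k\<close> stands for the Daehee numbers.\<close>

lemma binomial_product_frobenius_euler_expansion:
  assumes "l \<noteq> 1"
  shows "fact n * fps_nth (G * fps_binomial x) n =
    (\<Sum>m=0..n.
       (\<Sum>j=0..n - m. \<Sum>k=0..n - m - j.
          of_nat (s choose j) * of_nat ((n - j) choose k) * ffact (of_nat n) j
            * (1 - l) powi (- int j) * of_int (S1 (n - j - k) m) * (fact k * fps_nth G k))
       * frobenius_euler_poly s l m x)"
proof -
  let ?P = "(1 + fps_const (inverse (1 - l)) * fps_X) ^ s"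
  let ?H = "frobenius_euler_gf s l x oo fps_ln 1"
  have "G * fps_binomial x = ?P * (G * ?H)"
    by (subst frobenius_euler_gf_compose_ln[OF assms, of _ s]) (simp only: mult.left_commute)
  then have "fact n * fps_nth (G * fps_binomial x) n = fact n * fps_nth (?P * (G * ?H)) n"
    by (rule arg_cong[where f = "\<lambda>F. fact n * fps_nth F n"])
  also have "\<dots> = (\<Sum>j=0..n. \<Sum>k=0..n - j.
         fact n * (fps_nth ?P j * (fps_nth G k * fps_nth ?H (n - j - k))))"
    unfolding fps_mult_nth[of ?P] fps_mult_nth[of G] by (simp add: sum_distrib_left)
  also have "\<dots> = (\<Sum>j=0..n. \<Sum>k=0..n - j. \<Sum>m=0..n - j - k.
      of_nat (s choose j) * of_nat ((n - j) choose k) * ffact (of_nat n) j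
        * (1 - l) powi (- int j) * of_int (S1 (n - j - k) m) * (fact k * fps_nth G k)
        * frobenius_euler_poly s l m x)"
  proof (intro sum.cong refl)
    fix j k assume "j \<in> {0..n}" "k \<in> {0..n - j}"
    then have jk: "j + k \<le> n" by auto
    have "fact n * (fps_nth ?P j * (fps_nth G k * fps_nth ?H (n - j - k)))
      = of_nat (s choose j) * of_nat ((n - j) choose k) * ffact (of_nat n) j
        * inverse (1 - l) ^ j * (fact k * fps_nth G k) * (fact (n - j - k) * fps_nth ?H (n - j - k))"
      unfolding fact_eq_binomial_ffact[OF jk] one_plus_const_X_power_nth by (simp only: mult_ac)
    also have "inverse (1 - l) ^ j = (1 - l) powi (- int j)"
      by (simp add: power_int_minus power_inverse)
    finally show "fact n * (fps_nth ?P j * (fps_nth G k * fps_nth ?H (n - j - k)))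
      = (\<Sum>m=0..n - j - k.
      of_nat (s choose j) * of_nat ((n - j) choose k) * ffact (of_nat n) j
        * (1 - l) powi (- int j) * of_int (S1 (n - j - k) m) * (fact k * fps_nth G k)
        * frobenius_euler_poly s l m x)"
      unfolding frobenius_euler_gf_compose_ln_nth sum_distrib_left by (simp only: mult_ac)
  qed
  finally show ?thesis
    unfolding sum_distrib_right by (rule trans[OF _ sum_simplex_swap])
qed

theorem theorem9:
  fixes r s n :: nat and a :: "nat \<Rightarrow> complex" and l x :: complex
  assumes "r \<ge> 1"
    and "\<forall>j\<in>{1..r}. a j \<noteq> 0"
    and "l \<noteq> 1"
  shows
    "daehee_poly r a n x =
       (\<Sum>m=0..n.
          (\<Sum>j=0..n - m. \<Sum>k=0..n - m - j.
             of_nat (s choose j) * of_nat ((n - j) choose k) * ffact (of_nat n) j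
               * (1 - l) powi (- int j) * of_int (S1 (n - j - k) m) * daehee_number r a k)
          * frobenius_euler_poly s l m x)
     \<and>
     daehee2_poly r a n x =
       (\<Sum>m=0..n.
          (\<Sum>j=0..n - m. \<Sum>k=0..n - m - j.
             of_nat (s choose j) * of_nat ((n - j) choose k) * ffact (of_nat n) j
               * (1 - l) powi (- int j) * of_int (S1 (n - j - k) m) * daehee2_number r a k)
          * frobenius_euler_poly s l m x)"
  \<comment> \<open>\<open>G\<close> is the product over \<open>j\<close> in each generating
    function. At \<open>x = 0\<close> the factor \<open>fps_binomial x\<close> is 1, so
    \<open>G\<close> itself generates the numbers.\<close>
  unfolding daehee_poly_def daehee2_poly_def
  by (intro conjI; subst binomial_product_frobenius_euler_expansion[OF assms(3), symmetric])
    (simp_all add: daehee_gf_def daehee2_gf_def)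

end
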